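(* For every integer $n\ge 1$, the Cayley element $C_{\mathcal T}(x_0,x_1,\ldots,x_n):=x_0^{n-1}\sigma(x_n)$ of the Chebyshev first kind derivation $D_{\mathcal T}$ belongs to $\ker D_{\mathcal T}$ and is given by $$C_{\mathcal T}(x_0,\ldots,x_n)=x_nx_0^{n-1}+\sum_{k=1}^{n}\frac{(-2)^kn}{k!}\left(\sum_{i=0}^{\left[\frac{n-k}{2}\right]}(n-i-1)^{\underline{k-1}}\binom{k+i-1}{k-1}x_{n-k-2i}\,x_1^k\,x_0^{n-1-k}-\frac{1+(-1)^{n-k}}{4}\left(\frac{n+k}{2}-1\right)^{\underline{k-1}}\binom{\frac{n+k}{2}-1}{k-1}x_1^kx_0^{n-k}\right).$$
   Context: A derivation $D$ of $\mathbb{C}[x_0,\ldots,x_n]$ is a $\mathbb{C}$-linear map with $D(fg)=D(f)g+fD(g)$; it extends to the field of fractions by the quotient rule, and $\ker D=\{f\in\mathbb{C}[x_0,\ldots,x_n]: D(f)=0\}$. The Chebyshev first kind derivation $D_{\mathcal T}$ of $\mathbb{C}[x_0,\ldots,x_n]$ is given by $D_{\mathcal T}(x_0)=0$ and, for $1\le m\le n$, $$D_{\mathcal T}(x_m)=m\left(\sum_{k=1}^{m-1}\left(1-(-1)^k\right)x_{m-k}+\frac{1-(-1)^m}{2}x_0\right).$$ It is locally nilpotent, with $D_{\mathcal T}(x_1)=x_0$. Put $\lambda=-x_1/x_0$ (so $D_{\mathcal T}(\lambda)=-1$) and $\sigma(x_n)=\sum_{k=0}^{\infty}D_{\mathcal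 T}^k(x_n)\frac{\lambda^k}{k!}$ (a finite sum, an element of $\mathbb{C}[x_0,\ldots,x_n][x_0^{-1}]$). The elements $x_0^{n-1}\sigma(x_n)$ are called the Cayley elements of the Chebyshev first kind derivation. Notation: $[a]$ in summation limits is the integer part; $a^{\underline m}=a(a-1)\cdots(a-m+1)$ is the falling factorial ($a^{\underline 0}=1$), and $\binom{a}{m}=a^{\underline m}/m!$ for integers $m\ge0$ and arbitrary $a$. *)

theory Defs
  imports Complex_Main "HOL-Library.Poly_Mapping" "HOL-Computational_Algebra.Fraction_Field"
begin

text \<open>
  Polynomials over the complex numbers in the variables \<open>x\<^sub>0, x\<^sub>1, x\<^sub>2, \<dots>\<close>: a monomial is a
  finitely supported exponent function, a polynomial a finitely supported coefficient function.
  The ring in the variables \<open>x\<^sub>0, \<dots>, x\<^sub>n\<close> is the subring \<open>polys n\<close>.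
\<close>

type_synonym cpoly = "(nat \<Rightarrow>\<^sub>0 nat) \<Rightarrow>\<^sub>0 complex"

definition Const :: "complex \<Rightarrow> cpoly" where
  "Const c = Poly_Mapping.single 0 c"

definition Var :: "nat \<Rightarrow> cpoly" where
  "Var i = Poly_Mapping.single (Poly_Mapping.single i 1) 1"

definition polys :: "nat \<Rightarrow> cpoly set" where
  "polys n = {f. \<forall>m \<in> Poly_Mapping.keys f. Poly_Mapping.keys m \<subseteq> {..n}}"

text \<open>Only the values of \<open>D\<close> on \<open>polys n\<close> are constrained.\<close>

definition derivation_on :: "nat \<Rightarrow> (cpoly \<Rightarrow> cpoly) \<Rightarrow> bool" where
  "derivation_on n D \<longleftrightarrow>
     (\<forall>f \<in> polys n. D f \<in> polys n) \<and>
     (\<forall>f \<in> polys n. \<forall>g \<in> polys n. D (f + g) = D f + D g) \<and>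
     (\<forall>c. \<forall>f \<in> polys n. D (Const c * f) = Const c * D f) \<and>
     (\<forall>f \<in> polys n. \<forall>g \<in> polys n. D (f * g) = D f * g + f * D g)"

definition ker_deriv :: "nat \<Rightarrow> (cpoly \<Rightarrow> cpoly) \<Rightarrow> cpoly set" where
  "ker_deriv n D = {f \<in> polys n. D f = 0}"

definition chebT_image :: "nat \<Rightarrow> cpoly" where
  "chebT_image m =
     of_nat m * ((\<Sum>k = 1..<m. Const (1 - (-1) ^ k) * Var (m - k)) + Const ((1 - (-1) ^ m) / 2) * Var 0)"

definition chebT_derivation :: "nat \<Rightarrow> (cpoly \<Rightarrow> cpoly) \<Rightarrow> bool" where
  "chebT_derivation n D \<longleftrightarrow>
     derivation_on n D \<and> D (Var 0) = 0 \<and> (\<forall>m \<in> {1..n}. D (Var m) = chebT_image m)"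

definition emb :: "cpoly \<Rightarrow> cpoly fract" where
  "emb f = Fract f 1"

definition X :: "nat \<Rightarrow> cpoly fract" where
  "X i = emb (Var i)"

definition scal :: "complex \<Rightarrow> cpoly fract" where
  "scal c = emb (Const c)"

text \<open>
  \<open>Sum_any\<close> is the sum over all \<open>k\<close> of a finitely supported family; the family below has
  finite support by \<open>chebT_derivation_finite_support\<close>.
\<close>

definition sigma :: "(cpoly \<Rightarrow> cpoly) \<Rightarrow> cpoly \<Rightarrow> cpoly fract" where
  "sigma D f = Sum_any (\<lambda>k::nat. emb ((D ^^ k) f) * (- X 1 / X 0) ^ k / of_nat (fact k))"

definition cayley :: "nat \<Rightarrow> (cpoly \<Rightarrow> cpoly) \<Rightarrow> cpoly fract" where
  "cayley n D = X 0 ^ (n - 1) * sigma D (Var n)"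

definition falling_fact :: "complex \<Rightarrow> nat \<Rightarrow> complex" where
  "falling_fact a m = (\<Prod>i<m. a - of_nat i)"


subsection \<open>Closure properties\<close>

lemma polys_0 [simp]: "0 \<in> polys n"
  by (simp add: polys_def)

lemma polys_add: "f \<in> polys n \<Longrightarrow> g \<in> polys n \<Longrightarrow> f + g \<in> polys n"
  unfolding polys_def using Poly_Mapping.keys_add[of f g] by blast

lemma polys_mult:
  assumes "f \<in> polys n" "g \<in> polys n"
  shows "f * g \<in> polys n"
  unfolding polys_def
proof (intro CollectI ballI)
  fix m assume "m \<in> Poly_Mapping.keys (f * g)"
  then obtain a b where "m = a + b" "a \<in> Poly_Mapping.keys f" "b \<in> Poly_Mapping.keys g"
    using keys_mult[of f g] by blast
  then show "Poly_Mapping.keys m \<subseteq> {..n}"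
    using assms Poly_Mapping.keys_add[of a b] unfolding polys_def by blast
qed

lemma polys_sum: "(\<And>i. i \<in> A \<Longrightarrow> f i \<in> polys n) \<Longrightarrow> sum f A \<in> polys n"
  by (induction A rule: infinite_finite_induct) (auto intro: polys_add)

lemma polys_Const [simp]: "Const c \<in> polys n"
  by (simp add: polys_def Const_def)

lemma polys_Var: "i \<le> n \<Longrightarrow> Var i \<in> polys n"
  by (simp add: polys_def Var_def)

lemma of_nat_eq_Const: "of_nat m = Const (of_nat m)"
  by (simp add: Const_def)

lemma chebT_image_in_polys: "m \<le> n \<Longrightarrow> chebT_image m \<in> polys n"
  unfolding chebT_image_def of_nat_eq_Const
  by (intro polys_mult polys_add polys_sum polys_Const polys_Var) auto


subsection \<open>Existence of the derivation\<close>

definition mono_deriv :: "nat \<Rightarrow> (nat \<Rightarrow> cpoly) \<Rightarrow> (nat \<Rightarrow>\<^sub>0 nat) \<Rightarrow> cpoly" where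
  "mono_deriv n R m =
     (\<Sum>i\<le>n. Poly_Mapping.single (m - Poly_Mapping.single i 1) (of_nat (Poly_Mapping.lookup m i)) * R i)"

definition gen_deriv :: "nat \<Rightarrow> (nat \<Rightarrow> cpoly) \<Rightarrow> cpoly \<Rightarrow> cpoly" where
  "gen_deriv n R f = (\<Sum>m \<in> Poly_Mapping.keys f. Const (Poly_Mapping.lookup f m) * mono_deriv n R m)"

lemma gen_deriv_superset:
  assumes "finite A" "Poly_Mapping.keys f \<subseteq> A"
  shows "gen_deriv n R f = (\<Sum>m \<in> A. Const (Poly_Mapping.lookup f m) * mono_deriv n R m)"
  unfolding gen_deriv_def using assms
  by (intro sum.mono_neutral_left) (auto simp: Const_def in_keys_iff)

lemma gen_deriv_add: "gen_deriv n R (f + g) = gen_deriv n R f + gen_deriv n R g"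
proof -
  let ?A = "Poly_Mapping.keys f \<union> Poly_Mapping.keys g"
  have "gen_deriv n R h = (\<Sum>m \<in> ?A. Const (Poly_Mapping.lookup h m) * mono_deriv n R m)"
    if "Poly_Mapping.keys h \<subseteq> ?A" for h
    using that by (intro gen_deriv_superset) auto
  then show ?thesis
    by (simp add: Poly_Mapping.keys_add Const_def lookup_add single_add distrib_right sum.distrib)
qed

lemma gen_deriv_sum: "gen_deriv n R (sum h A) = (\<Sum>a\<in>A. gen_deriv n R (h a))"
  by (induction A rule: infinite_finite_induct) (auto simp: gen_deriv_add, auto simp: gen_deriv_def)

lemma gen_deriv_single: "gen_deriv n R (Poly_Mapping.single m c) = Const c * mono_deriv n R m"
  by (subst gen_deriv_superset[where A = "{m}"]) auto

lemma sum_singles: "f = (\<Sum>m \<in> Poly_Mapping.keys f. Poly_Mapping.single m (Poly_Mapping.lookup f m))"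
  by (rule poly_mapping_eqI) (auto simp: lookup_sum lookup_single when_def in_keys_iff)

lemma mono_deriv_add:
  "mono_deriv n R (a + b) =
     mono_deriv n R a * Poly_Mapping.single b 1 + Poly_Mapping.single a 1 * mono_deriv n R b"
proof -
  have *: "Poly_Mapping.single (a + b - Poly_Mapping.single i 1) (of_nat (Poly_Mapping.lookup a i) :: complex)
     = Poly_Mapping.single (a - Poly_Mapping.single i 1) (of_nat (Poly_Mapping.lookup a i)) * Poly_Mapping.single b 1"
    for a b :: "nat \<Rightarrow>\<^sub>0 nat" and i
  proof (cases "Poly_Mapping.lookup a i = 0")
    case False
    have "a + b - Poly_Mapping.single i 1 = a - Poly_Mapping.single i 1 + b"
      using False by (intro poly_mapping_eqI) (auto simp: lookup_add lookup_minus lookup_single when_def)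
    then show ?thesis by (simp add: mult_single)
  qed auto
  have "Poly_Mapping.single (a + b - Poly_Mapping.single i 1) (of_nat (Poly_Mapping.lookup (a + b) i) :: complex)
     = Poly_Mapping.single (a - Poly_Mapping.single i 1) (of_nat (Poly_Mapping.lookup a i)) * Poly_Mapping.single b 1
     + Poly_Mapping.single a 1 * Poly_Mapping.single (b - Poly_Mapping.single i 1) (of_nat (Poly_Mapping.lookup b i))" for i
    using *[of a b i] *[of b a i] by (simp add: lookup_add single_add add.commute mult.commute)
  then show ?thesis
    by (simp add: mono_deriv_def distrib_left distrib_right sum.distrib sum_distrib_left sum_distrib_right mult_ac)
qed

lemma gen_deriv_mult: "gen_deriv n R (f * g) = gen_deriv n R f * g + f * gen_deriv n R g"
proof -
  have mono: "gen_deriv n R (Poly_Mapping.single a c * Poly_Mapping.single b d)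
     = gen_deriv n R (Poly_Mapping.single a c) * Poly_Mapping.single b d
     + Poly_Mapping.single a c * gen_deriv n R (Poly_Mapping.single b d)" for a b c d
  proof -
    have [simp]: "Poly_Mapping.single a c = Const c * Poly_Mapping.single a 1"
      "Poly_Mapping.single b d = Const d * Poly_Mapping.single b 1"
      by (simp_all add: Const_def mult_single)
    have "Const (c * d) = Const c * Const d" by (simp add: Const_def mult_single)
    then show ?thesis
      unfolding mult_single gen_deriv_single mono_deriv_add by (simp add: algebra_simps)
  qed
  have right: "gen_deriv n R (Poly_Mapping.single a c * g)
     = gen_deriv n R (Poly_Mapping.single a c) * g + Poly_Mapping.single a c * gen_deriv n R g" for a c
    by (subst (1 2 3) sum_singles[of g])
      (simp add: sum_distrib_left gen_deriv_sum mono sum.distrib)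
  show ?thesis
    by (subst (1 2 3) sum_singles[of f])
      (simp add: sum_distrib_right gen_deriv_sum right sum.distrib)
qed

lemma gen_deriv_Const: "gen_deriv n R (Const c) = 0"
  by (simp add: Const_def gen_deriv_single mono_deriv_def)

lemma gen_deriv_Var:
  assumes "i \<le> n"
  shows "gen_deriv n R (Var i) = R i"
proof -
  have "mono_deriv n R (Poly_Mapping.single i 1) = (\<Sum>j\<le>n. if j = i then R i else 0)"
    unfolding mono_deriv_def by (intro sum.cong) (auto simp: lookup_single when_def)
  then show ?thesis
    using assms by (simp add: Var_def gen_deriv_single Const_def)
qed

lemma gen_deriv_in_polys:
  assumes "\<And>i. i \<le> n \<Longrightarrow> R i \<in> polys n" "f \<in> polys n"
  shows "gen_deriv n R f \<in> polys n"
  unfolding gen_deriv_def mono_deriv_def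
proof (intro polys_sum polys_mult polys_Const assms)
  fix m i assume m: "m \<in> Poly_Mapping.keys f"
  have "Poly_Mapping.keys (m - Poly_Mapping.single i 1) \<subseteq> Poly_Mapping.keys m"
    by (auto simp: in_keys_iff lookup_minus)
  then show "Poly_Mapping.single (m - Poly_Mapping.single i 1) (of_nat (Poly_Mapping.lookup m i)) \<in> polys n"
    using m assms(2) by (auto simp: polys_def)
qed auto

lemma chebT_derivation_exists: "\<exists>D. chebT_derivation n D"
proof
  let ?D = "gen_deriv n chebT_image"
  have "chebT_image 0 = 0" by (simp add: chebT_image_def)
  then show "chebT_derivation n ?D"
    by (auto simp: chebT_derivation_def derivation_on_def gen_deriv_add gen_deriv_mult
        gen_deriv_Const gen_deriv_Var intro!: gen_deriv_in_polys chebT_image_in_polys)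
qed


subsection \<open>Local nilpotency on the variables\<close>

lemma derivation_on_0: "derivation_on n D \<Longrightarrow> D 0 = 0"
  unfolding derivation_on_def by (metis add_cancel_right_right polys_0)

lemma derivation_on_funpow:
  assumes "derivation_on n D"
  shows "f \<in> polys n \<Longrightarrow> (D ^^ k) f \<in> polys n"
    and "f \<in> polys n \<Longrightarrow> g \<in> polys n \<Longrightarrow> (D ^^ k) (f + g) = (D ^^ k) f + (D ^^ k) g"
    and "f \<in> polys n \<Longrightarrow> (D ^^ k) (Const c * f) = Const c * (D ^^ k) f"
    and "(D ^^ k) 0 = 0"
proof -
  have 1: "(D ^^ k) f \<in> polys n" if "f \<in> polys n" for f k
    using that assms by (induction k) (auto simp: derivation_on_def)
  show "f \<in> polys n \<Longrightarrow> (D ^^ k) f \<in> polys n" by (rule 1)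
  show "f \<in> polys n \<Longrightarrow> g \<in> polys n \<Longrightarrow> (D ^^ k) (f + g) = (D ^^ k) f + (D ^^ k) g"
    using assms 1 by (induction k) (auto simp: derivation_on_def)
  show "f \<in> polys n \<Longrightarrow> (D ^^ k) (Const c * f) = Const c * (D ^^ k) f"
    using assms 1 by (induction k) (simp, simp, metis derivation_on_def)
  show "(D ^^ k) 0 = 0"
    using derivation_on_0[OF assms] by (induction k) auto
qed

lemma derivation_on_funpow_sum_eq_0:
  assumes "derivation_on n D" "\<And>i. i \<in> A \<Longrightarrow> f i \<in> polys n \<and> (D ^^ k) (f i) = 0"
  shows "(D ^^ k) (sum f A) = 0"
  using assms(2)
  by (induction A rule: infinite_finite_induct)
    (auto simp: derivation_on_funpow[OF assms(1)] polys_sum)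

lemma chebT_derivation_nilpotent:
  assumes D: "chebT_derivation n D" and "m \<le> n" "k > m"
  shows "(D ^^ k) (Var m) = 0"
  using assms(2,3)
proof (induction m arbitrary: k rule: less_induct)
  case (less m)
  have der: "derivation_on n D" using D by (simp add: chebT_derivation_def)
  note [simp] = derivation_on_funpow[OF der]
  obtain j where k: "k = Suc j" "j \<ge> m" using less.prems by (cases k) auto
  show ?case
  proof (cases "m = 0")
    case True
    then show ?thesis using D k by (simp add: chebT_derivation_def funpow_Suc_right del: funpow.simps)
  next
    case False
    have V: "Var i \<in> polys n \<and> (D ^^ j) (Var i) = 0" if "i < m" for i
      using less that k by (auto intro: polys_Var)
    let ?S = "\<Sum>k = 1..<m. Const (1 - (-1) ^ k) * Var (m - k)"
    have S: "?S \<in> polys n"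
      using V False by (intro polys_sum polys_mult polys_Const) auto
    have "(D ^^ j) ?S = 0"
      using V by (intro derivation_on_funpow_sum_eq_0[OF der] conjI polys_mult) auto
    moreover have "(D ^^ j) (Const ((1 - (-1) ^ m) / 2) * Var 0) = 0"
      using V[of 0] False by simp
    ultimately have "(D ^^ j) (chebT_image m) = 0"
      unfolding chebT_image_def of_nat_eq_Const using V[of 0] False S
      by (simp add: polys_add polys_mult)
    moreover have "D (Var m) = chebT_image m"
      using D False less.prems by (auto simp: chebT_derivation_def)
    ultimately show ?thesis
      by (simp add: k funpow_Suc_right del: funpow.simps)
  qed
qed

lemma chebT_derivation_finite_support:
  assumes "chebT_derivation n D" "m \<le> n"
  shows "finite {k. emb ((D ^^ k) (Var m)) * (- X 1 / X 0) ^ k / of_nat (fact k) \<noteq> 0}"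
proof (rule finite_subset)
  have "emb 0 = 0" by (simp add: emb_def Zero_fract_def)
  then have "emb ((D ^^ k) (Var m)) = 0" if "k > m" for k
    using chebT_derivation_nilpotent[OF assms that] by simp
  then show "{k. emb ((D ^^ k) (Var m)) * (- X 1 / X 0) ^ k / of_nat (fact k) \<noteq> 0} \<subseteq> {..m}"
    by (auto intro: leI)
qed auto

end

theory Submission
  imports Defs
begin

text \<open>
  Writing \<open>y\<^sub>0 = x\<^sub>0 / 2\<close> and \<open>y\<^sub>j = x\<^sub>j\<close> for \<open>j > 0\<close>, the derivation takes the form
  \<open>D x\<^sub>m = 2 m (y\<^bsub>m-1\<^esub> + y\<^bsub>m-3\<^esub> + \<dots>)\<close>, just like the derivatives of Chebyshev polynomials.
  Iterating it gives \<open>D\<^sup>k x\<^sub>n = 2\<^sup>k n (\<Sum>i. a\<^sub>k\<^sub>,\<^sub>i y\<^bsub>n-k-2i\<^esub>)\<close>, because the coefficients \<open>a\<^sub>k\<^sub>,\<^sub>i\<close>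
  of the theorem satisfy \<open>a\<^bsub>k+1,s\<^esub> = (\<Sum>i\<le>s. (n - k - 2i) a\<^sub>k\<^sub>,\<^sub>i)\<close>.  The Cayley element is a polynomial
  since \<open>D\<^sup>n x\<^sub>n\<close> is a multiple of \<open>x\<^sub>0\<close>, and the derivative of the Dixmier sum telescopes to \<open>0\<close>.
\<close>

subsection \<open>Embedding the constants and the polynomials\<close>

lemma Const_simps:
  "Const 0 = 0" "Const 1 = 1" "Const (a + b) = Const a + Const b" "Const (a * b) = Const a * Const b"
  "Const (- a) = - Const a" "Const (a - b) = Const a - Const b"
  by (simp_all add: Const_def single_add mult_single single_uminus single_diff)

lemma Const_sum: "Const (sum f A) = (\<Sum>a\<in>A. Const (f a))"
  by (induction A rule: infinite_finite_induct) (simp_all add: Const_simps)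

lemma Const_numeral: "Const (numeral w) = numeral w"
  using of_nat_eq_Const[of "numeral w"] by simp

lemma Var_neq_0: "Var i \<noteq> 0"
  by (metis Var_def lookup_single_eq lookup_zero one_neq_zero)

lemma emb_simps:
  "emb 0 = 0" "emb 1 = 1" "emb (f + g) = emb f + emb g" "emb (f * g) = emb f * emb g"
  "emb (- f) = - emb f" "emb (f - g) = emb f - emb g"
  by (simp_all add: emb_def Zero_fract_def One_fract_def)

lemma emb_sum: "emb (sum f A) = (\<Sum>a\<in>A. emb (f a))"
  by (induction A rule: infinite_finite_induct) (simp_all add: emb_simps)

lemma emb_power: "emb (f ^ k) = emb f ^ k"
  by (induction k) (simp_all add: emb_simps)

lemma emb_eq_0_iff: "emb f = 0 \<longleftrightarrow> f = 0"
  by (simp add: emb_def Zero_fract_def eq_fract)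

lemma X_neq_0: "X i \<noteq> 0"
  by (simp add: X_def emb_eq_0_iff Var_neq_0)

lemma scal_simps:
  "scal 0 = 0" "scal 1 = 1" "scal (a + b) = scal a + scal b" "scal (a * b) = scal a * scal b"
  "scal (- a) = - scal a" "scal (a - b) = scal a - scal b"
  by (simp_all add: scal_def Const_simps emb_simps)

lemma scal_power: "scal (c ^ k) = scal c ^ k"
  by (induction k) (simp_all add: scal_simps)

lemma scal_of_nat: "scal (of_nat k) = of_nat k"
  by (induction k) (simp_all add: scal_simps)

lemma scal_inverse: "scal (inverse c) = inverse (scal c)"
\<comment> \<open>At \<open>c = 0\<close> both sides are 0, by the convention
  \<open>inverse 0 = 0\<close>.\<close>
proof (cases "c = 0")
  case False
  then have "scal c * scal (inverse c) = 1"
    by (simp add: scal_simps(2) flip: scal_simps(4))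
  then show ?thesis
    by (metis inverse_unique)
qed (simp add: scal_simps)

lemma scal_divide: "scal (a / b) = scal a / scal b"
  by (simp add: divide_inverse scal_simps scal_inverse)


subsection \<open>Derivations\<close>

lemma polys_minus: "f \<in> polys n \<Longrightarrow> - f \<in> polys n"
  using polys_mult[OF polys_Const[of "-1"]] by (simp add: Const_simps)

lemma polys_power: "f \<in> polys n \<Longrightarrow> f ^ k \<in> polys n"
  using polys_Const[of 1] by (induction k) (auto intro: polys_mult simp: Const_simps)

lemma derivation_on_add:
  "derivation_on n D \<Longrightarrow> f \<in> polys n \<Longrightarrow> g \<in> polys n \<Longrightarrow> D (f + g) = D f + D g"
  unfolding derivation_on_def by blast

lemma derivation_on_sum:
  assumes "derivation_on n D" "\<And>i. i \<in> A \<Longrightarrow> f i \<in> polys n"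
  shows "D (sum f A) = (\<Sum>i\<in>A. D (f i))"
  using assms(2)
proof (induction A rule: infinite_finite_induct)
  case (insert a A)
  then have "D (f a + sum f A) = D (f a) + D (sum f A)"
    by (intro derivation_on_add[OF assms(1)] polys_sum) auto
  then show ?case
    using insert by simp
qed (simp_all add: derivation_on_0[OF assms(1)])

lemma derivation_on_Const_mult: "derivation_on n D \<Longrightarrow> f \<in> polys n \<Longrightarrow> D (Const c * f) = Const c * D f"
  unfolding derivation_on_def by blast

lemma derivation_on_mult:
  "derivation_on n D \<Longrightarrow> f \<in> polys n \<Longrightarrow> g \<in> polys n \<Longrightarrow> D (f * g) = D f * g + f * D g"
  unfolding derivation_on_def by blast

lemma derivation_on_uminus: "derivation_on n D \<Longrightarrow> f \<in> polys n \<Longrightarrow> D (- f) = - D f"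
  using derivation_on_Const_mult[of n D f "-1"] by (simp add: Const_simps)

lemma derivation_on_1: "derivation_on n D \<Longrightarrow> D 1 = 0"
  using derivation_on_mult[of n D 1 1] polys_Const[of 1] by (simp add: Const_simps)

lemma derivation_on_power:
  assumes "derivation_on n D" "f \<in> polys n"
  shows "D (f ^ k) = of_nat k * f ^ (k - 1) * D f"
proof (induction k)
  case (Suc k)
  have "D (f ^ Suc k) = D f * f ^ k + of_nat k * (f ^ (k - 1) * f) * D f"
    using derivation_on_mult[OF assms(1,2) polys_power[OF assms(2)], of k] Suc
    by (simp add: algebra_simps)
  \<comment> \<open>At \<open>k = 0\<close> the truncated exponent is wrong, but the factor
    \<open>of_nat k\<close> vanishes.\<close>
  also have "of_nat k * (f ^ (k - 1) * f) = of_nat k * f ^ k"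
    by (cases k) (simp_all add: mult.commute)
  finally show ?case
    by (simp add: algebra_simps)
qed (simp add: derivation_on_1[OF assms(1)])

text \<open>When \<open>D\<close> iterated more than \<open>n\<close> times kills \<open>f\<close>,
  this is \<open>x_0^n\<close> times \<open>sigma D f\<close>. Clearing the denominators gives a
  polynomial, to which \<open>D\<close> can be applied.\<close>

definition dixmier_sum :: "nat \<Rightarrow> (cpoly \<Rightarrow> cpoly) \<Rightarrow> cpoly \<Rightarrow> cpoly" where
  "dixmier_sum n D f =
     (\<Sum>k\<le>n. Const (1 / fact k) * ((D ^^ k) f * (- Var 1) ^ k * Var 0 ^ (n - k)))"

text \<open>The summands have derivatives \<open>G k - G (k - 1)\<close>, so the sum telescopes to
  \<open>G n\<close>, which contains the factor \<open>(D ^^ Suc n) f\<close>.\<close>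

lemma derivation_on_dixmier_sum:
  assumes D: "derivation_on n D" "D (Var 0) = 0" "D (Var 1) = Var 0"
    and n: "n \<ge> 1" and f: "f \<in> polys n" "(D ^^ Suc n) f = 0"
  shows "D (dixmier_sum n D f) = 0"
proof -
  \<comment> \<open>The part of the derivative of the \<open>k\<close>-th summand in which
    \<open>D\<close> hits \<open>(D ^^ k) f\<close>.\<close>
  define G where "G k = Const (1 / fact k) * ((D ^^ Suc k) f * (- Var 1) ^ k * Var 0 ^ (n - k))" for k
  note pI = polys_mult polys_power polys_minus polys_Const polys_Var derivation_on_funpow(1)[OF D(1)]
  have V: "Var 0 \<in> polys n" "Var 1 \<in> polys n"
    using n by (auto intro: polys_Var)
  have d0: "D (Var 0 ^ j) = 0" for j
    by (simp add: derivation_on_power[OF D(1) V(1)] D)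
  have d1: "D ((- Var 1) ^ j) = - of_nat j * (- Var 1) ^ (j - 1) * Var 0" for j
    using derivation_on_power[OF D(1) polys_minus[OF V(2)], of j] V
    by (simp add: derivation_on_uminus[OF D(1)] D del: One_nat_def)
  have telescope: "D (Const (1 / fact k) * ((D ^^ k) f * (- Var 1) ^ k * Var 0 ^ (n - k))) =
      G k - (if k = 0 then 0 else G (k - 1))" if "k \<le> n" for k
  proof -
    have prod: "D ((D ^^ k) f * (- Var 1) ^ k * Var 0 ^ (n - k)) =
        ((D ^^ Suc k) f * (- Var 1) ^ k - of_nat k * (D ^^ k) f * (- Var 1) ^ (k - 1) * Var 0) * Var 0 ^ (n - k)"
      using V n f by (simp add: derivation_on_mult[OF D(1)] pI d0 d1 algebra_simps del: One_nat_def)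
    have scale: "D (Const (1 / fact k) * ((D ^^ k) f * (- Var 1) ^ k * Var 0 ^ (n - k))) =
        Const (1 / fact k) * D ((D ^^ k) f * (- Var 1) ^ k * Var 0 ^ (n - k))"
      using V n f by (intro derivation_on_Const_mult[OF D(1)] pI) auto
    have "D (Const (1 / fact k) * ((D ^^ k) f * (- Var 1) ^ k * Var 0 ^ (n - k))) =
        G k - Const (1 / fact k) * of_nat k * ((D ^^ k) f * (- Var 1) ^ (k - 1) * (Var 0 * Var 0 ^ (n - k)))"
      unfolding scale prod by (simp add: G_def algebra_simps)
    \<comment> \<open>The part in which \<open>D\<close> hits \<open>(- Var 1) ^ k\<close>: the new
      factor \<open>Var 0\<close> raises its exponent to \<open>n - (k - 1)\<close>, and
      \<open>k / k! = 1 / (k - 1)!\<close>.\<close>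
    moreover have "Const (1 / fact k) * of_nat k * ((D ^^ k) f * (- Var 1) ^ (k - 1) * (Var 0 * Var 0 ^ (n - k)))
        = (if k = 0 then 0 else G (k - 1))"
    proof (cases k)
      case (Suc j)
      then have "n - j = Suc (n - k)"
        using that by auto
      moreover have "Const (1 / fact k) * of_nat k = Const (1 / fact j)"
        unfolding of_nat_eq_Const Const_simps(4)[symmetric] by (simp add: Suc del: of_nat_Suc)
      ultimately show ?thesis
        by (simp add: G_def Suc)
    qed simp
    ultimately show ?thesis
      by simp
  qed
  have "D (dixmier_sum n D f) = (\<Sum>k\<le>n. G k - (if k = 0 then 0 else G (k - 1)))"
    unfolding dixmier_sum_def using V n f telescope
    by (subst derivation_on_sum[OF D(1)]) (auto intro!: pI)
  also have "\<dots> = G n"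
    by (induction n) auto
  finally show ?thesis
    using f by (simp add: G_def)
qed


subsection \<open>Iterates of the Chebyshev derivation\<close>

definition halfvar :: "nat \<Rightarrow> cpoly" where
  "halfvar j = (if j = 0 then Const (1/2) * Var 0 else Var j)"

text \<open>Meant for \<open>k > 0\<close>: at \<open>k = 0\<close> the truncated
  \<open>k - 1\<close> would make every coefficient 1.\<close>

definition cheb_coeff :: "nat \<Rightarrow> nat \<Rightarrow> nat \<Rightarrow> complex" where
  "cheb_coeff n k i =
     falling_fact (of_nat n - of_nat i - 1) (k - 1) * ((of_nat k + of_nat i - 1) gchoose (k - 1))"

lemma halfvar_in_polys: "j \<le> n \<Longrightarrow> halfvar j \<in> polys n"
  by (simp add: halfvar_def polys_Var polys_mult)

text \<open>The weight is 2 at even \<open>k\<close> and 0 at odd \<open>k\<close>, so the induction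
  goes in steps of two.\<close>

lemma sum_even_halfvar:
  "(\<Sum>k\<le>M. Const (1 + (-1) ^ k) * halfvar (M - k)) = Const 2 * (\<Sum>i\<le>M div 2. halfvar (M - 2 * i))"
proof (induction M rule: induct_nat_012)
  case (ge2 M)
  have "(\<Sum>k\<le>Suc (Suc M). Const (1 + (-1) ^ k) * halfvar (Suc (Suc M) - k)) =
      Const 2 * halfvar (Suc (Suc M)) + (\<Sum>k\<le>M. Const (1 + (-1) ^ k) * halfvar (M - k))"
    by (simp add: sum.atMost_Suc_shift Const_simps Const_numeral del: sum.atMost_Suc)
  then show ?case
    unfolding ge2 by (simp add: sum.atMost_Suc_shift distrib_left Const_numeral del: sum.atMost_Suc)
qed (simp_all add: Const_simps Const_numeral)

text \<open>For \<open>m = M + 1\<close>, shifting \<open>k\<close> by one turns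
  \<open>1 - (-1)^k\<close> into \<open>1 + (-1)^k\<close>, and the separate \<open>x_0\<close> term
  becomes the last summand, with \<open>halfvar 0\<close> supplying its factor 1/2.\<close>

lemma chebT_image_eq:
  "chebT_image m = Const (2 * of_nat m) * (\<Sum>i\<le>(m - 1) div 2. halfvar (m - 1 - 2 * i))"
proof (cases m)
  case (Suc M)
  have "(\<Sum>k\<le>M. Const (1 + (-1) ^ k) * halfvar (M - k)) =
      (\<Sum>k<M. Const (1 + (-1) ^ k) * Var (M - k)) + Const ((1 + (-1) ^ M) / 2) * Var 0"
    by (simp add: lessThan_Suc_atMost[symmetric] halfvar_def mult.assoc[symmetric] Const_simps(4)[symmetric])
  also have "(\<Sum>k<M. Const (1 + (-1) ^ k) * Var (M - k)) =
      (\<Sum>k = 1..<m. Const (1 - (-1) ^ k) * Var (m - k))"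
    unfolding Suc by (rule sum.reindex_bij_witness[of _ "\<lambda>k. k - 1" Suc]) auto
  finally have "chebT_image m = of_nat m * (\<Sum>k\<le>M. Const (1 + (-1) ^ k) * halfvar (M - k))"
    by (simp add: chebT_image_def Suc)
  then show ?thesis
    unfolding sum_even_halfvar by (simp only: Suc of_nat_eq_Const Const_simps mult_ac diff_Suc_1)
qed (simp add: chebT_image_def Const_simps)

text \<open>Regroups by \<open>s = i + j\<close>, in order to collect all contributions to one
  variable.\<close>

lemma sum_triangle_diagonals:
  fixes n :: nat
  shows "(\<Sum>i\<le>n. \<Sum>j\<le>n - i. g i j) = (\<Sum>s\<le>n. \<Sum>i\<le>s. g i (s - i))"
proof -
  have "(\<Sum>i\<le>n. \<Sum>j\<le>n - i. g i j) = (\<Sum>(i, j)\<in>(SIGMA i:{..n}. {..n - i}). g i j)"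
    by (rule sum.Sigma) auto
  also have "(SIGMA i:{..n}. {..n - i}) = {(i, j). i + j \<le> n}"
    by auto
  finally show ?thesis
    by (simp only: sum.triangle_reindex_eq)
qed

section \<open>Recursion of the coefficients, and the iterates it yields\<close>

lemma falling_fact_Suc: "falling_fact a (Suc k) = falling_fact a k * (a - of_nat k)"
  by (simp add: falling_fact_def)

lemma falling_fact_Suc_left: "falling_fact a (Suc k) = a * falling_fact (a - 1) k"
  by (simp add: falling_fact_def prod.lessThan_Suc_shift diff_diff_eq del: prod.lessThan_Suc)

text \<open>By absorption both sides equal \<open>a * ((a - 1) gchoose k)\<close>.\<close>

lemma gbinomial_Suc_times: "of_nat (Suc k) * (a gchoose Suc k) = (a - of_nat k) * ((a::complex) gchoose k)"
  by (metis gbinomial_absorb_comp gbinomial_absorption)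

lemma cheb_coeff_Suc_0: "cheb_coeff n (Suc 0) i = 1"
  by (simp add: cheb_coeff_def falling_fact_def)

lemma sum_cheb_coeff:
  assumes "k \<ge> 1"
  shows "(\<Sum>i\<le>s. cheb_coeff n k i * (of_nat n - of_nat k - 2 * of_nat i)) = cheb_coeff n (Suc k) s"
proof -
  obtain j where k: "k = Suc j"
    using assms by (cases k) auto
  show ?thesis
  proof (induction s)
    case 0
    have "of_nat (Suc j) gchoose Suc j = (1::complex)"
      by (simp only: binomial_gbinomial[symmetric] binomial_n_n of_nat_1)
    then show ?case
      by (simp add: cheb_coeff_def k falling_fact_Suc binomial_gbinomial[symmetric] algebra_simps)
    next
    case (Suc s)
    \<comment> \<open>All three coefficients in the step are expressed through \<open>f\<close>,
      \<open>c\<close> and \<open>b\<close>: a factor of the falling factorial is split off at its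
      left or right end, and Pascal's rule splits the binomial.\<close>
    define N S f c b where "N = (of_nat n :: complex)" and "S = (of_nat s :: complex)"
      and "f = falling_fact (N - S - 2) j"
      and "c = (of_nat j + S + 1) gchoose j" and "b = (of_nat j + S + 1) gchoose Suc j"
    have sum: "of_nat j + S + 2 gchoose Suc j = c + b"
      using gbinomial_Suc_Suc[of "of_nat j + S + 1" j] by (simp add: b_def c_def add.assoc)
    have b: "of_nat (Suc j) * b = (S + 1) * c"
      using gbinomial_Suc_times[of j "of_nat j + S + 1"] by (simp add: b_def c_def)
    have "cheb_coeff n (Suc k) (Suc s) = f * (N - S - 2 - of_nat j) * (c + b)"
      using sum by (simp add: cheb_coeff_def k falling_fact_Suc N_def S_def f_def algebra_simps)
    moreover have "cheb_coeff n (Suc k) s = (N - S - 1) * f * b"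
      by (simp add: cheb_coeff_def k falling_fact_Suc_left N_def S_def f_def b_def algebra_simps)
    moreover have "cheb_coeff n k (Suc s) = f * c"
      by (simp add: cheb_coeff_def k N_def S_def f_def c_def algebra_simps)
    \<comment> \<open>The two sides differ by \<open>f * (of_nat (Suc j) * b - (S + 1) * c)\<close>,
      which is 0 by absorption.\<close>
    moreover have "(N - S - 1) * f * b + f * c * (N - of_nat (Suc j) - 2 * (S + 1)) =
        f * (N - S - 2 - of_nat j) * (c + b)"
      using b by simp algebra
    moreover have "(\<Sum>i\<le>Suc s. cheb_coeff n k i * (of_nat n - of_nat k - 2 * of_nat i)) =
        cheb_coeff n (Suc k) s + cheb_coeff n k (Suc s) * (N - of_nat (Suc j) - 2 * (S + 1))"
      unfolding sum.atMost_Suc Suc by (simp add: k N_def S_def add.commute)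
    ultimately show ?case
      by simp
  qed
qed

lemma chebT_derivation_funpow:
  assumes D: "chebT_derivation n D" and k: "1 \<le> k" "k \<le> n"
  shows "(D ^^ k) (Var n) =
    Const (2 ^ k * of_nat n) * (\<Sum>i\<le>(n - k) div 2. Const (cheb_coeff n k i) * halfvar (n - k - 2 * i))"
  using k
proof (induction k rule: nat_induct_at_least)
  case base
  then have "D (Var n) = chebT_image n"
    using D by (simp add: chebT_derivation_def)
  then show ?case
    by (simp add: chebT_image_eq cheb_coeff_Suc_0 Const_simps)
next
  case (Suc k)
  have der: "derivation_on n D"
    using D by (simp add: chebT_derivation_def)
  define H where "H = (n - Suc k) div 2"
  \<comment> \<open>The inner sum of \<open>D (halfvar (n - k - 2 * i))\<close>; the bound
    \<open>H - i\<close> makes the double sum range over the triangle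
    \<open>i + j \<le> H\<close>.\<close>
  let ?W = "\<lambda>i. \<Sum>j\<le>H - i. halfvar (n - Suc k - 2 * (i + j))"
  have D_Var: "D (Var m) = chebT_image m" if "m \<le> n" for m
  proof (cases "m = 0")
    case True
    then show ?thesis
      using D by (simp add: chebT_derivation_def chebT_image_def)
  qed (use that D in \<open>auto simp: chebT_derivation_def\<close>)
  \<comment> \<open>Halving does no harm: at \<open>m = 0\<close> both sides are 0.\<close>
  have D_halfvar: "D (halfvar m) = chebT_image m" if "m \<le> n" for m
    using that D_Var[of m] derivation_on_Const_mult[OF der polys_Var[of 0 n]]
    by (auto simp: halfvar_def chebT_image_def)
  have step: "D (halfvar (n - k - 2 * i)) = Const (2 * (of_nat n - of_nat k - 2 * of_nat i)) * ?W i"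
    if i: "i \<le> (n - k) div 2" for i
  proof -
    have "of_nat (n - k - 2 * i) = (of_nat n - of_nat k - 2 * of_nat i :: complex)"
      using i Suc.prems by (simp add: of_nat_diff)
    moreover have "(n - k - 2 * i - 1) div 2 = H - i" "\<And>j. n - k - 2 * i - 1 - 2 * j = n - Suc k - 2 * (i + j)"
      unfolding H_def by (simp_all)
    ultimately show ?thesis
      by (simp add: D_halfvar chebT_image_eq)
  qed
  have "(D ^^ Suc k) (Var n) = D (Const (2 ^ k * of_nat n) *
      (\<Sum>i\<le>(n - k) div 2. Const (cheb_coeff n k i) * halfvar (n - k - 2 * i)))"
    using Suc by simp
  also have "\<dots> = Const (2 ^ k * of_nat n) *
      (\<Sum>i\<le>(n - k) div 2. Const (cheb_coeff n k i) * D (halfvar (n - k - 2 * i)))"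
    by (simp add: derivation_on_Const_mult[OF der] derivation_on_sum[OF der]
        polys_sum polys_mult halfvar_in_polys)
  also have "(\<Sum>i\<le>(n - k) div 2. Const (cheb_coeff n k i) * D (halfvar (n - k - 2 * i))) = Const 2 *
      (\<Sum>i\<le>(n - k) div 2. Const (cheb_coeff n k i * (of_nat n - of_nat k - 2 * of_nat i)) * ?W i)"
    by (subst sum_distrib_left, intro sum.cong refl) (simp only: step atMost_iff, simp only: Const_simps mult_ac)
  \<comment> \<open>The ranges differ only for even \<open>n - k\<close>, by the index with
    \<open>n = k + 2 * i\<close>, where the coefficient has the factor 0.\<close>
  also have "(\<Sum>i\<le>(n - k) div 2. Const (cheb_coeff n k i * (of_nat n - of_nat k - 2 * of_nat i)) * ?W i) =
      (\<Sum>i\<le>H. Const (cheb_coeff n k i * (of_nat n - of_nat k - 2 * of_nat i)) * ?W i)"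
  proof (rule sum.mono_neutral_right)
    show "\<forall>i\<in>{..(n - k) div 2} - {..H}.
        Const (cheb_coeff n k i * (of_nat n - of_nat k - 2 * of_nat i)) * ?W i = 0"
    proof
      fix i assume "i \<in> {..(n - k) div 2} - {..H}"
      then have "n = k + 2 * i"
        using Suc.prems by (auto simp: H_def)
      then show "Const (cheb_coeff n k i * (of_nat n - of_nat k - 2 * of_nat i)) * ?W i = 0"
        by (simp add: Const_simps)
    qed
  qed (auto simp: H_def)
  \<comment> \<open>The variable depends only on \<open>s = i + j\<close>; its coefficient is then
    the partial sum in \<open>sum_cheb_coeff\<close>.\<close>
  also have "(\<Sum>i\<le>H. Const (cheb_coeff n k i * (of_nat n - of_nat k - 2 * of_nat i)) * ?W i) =
      (\<Sum>s\<le>H. \<Sum>i\<le>s.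
      Const (cheb_coeff n k i * (of_nat n - of_nat k - 2 * of_nat i)) * halfvar (n - Suc k - 2 * s))"
    by (simp only: sum_distrib_left sum_triangle_diagonals) (intro sum.cong refl, simp)
  also have "\<dots> = (\<Sum>s\<le>H. Const (cheb_coeff n (Suc k) s) * halfvar (n - Suc k - 2 * s))"
    using Suc.hyps by (simp add: sum_distrib_right[symmetric] Const_sum[symmetric] sum_cheb_coeff)
  finally show ?case
    by (simp only: H_def Const_simps power_Suc mult_ac)
qed

section \<open>The summands of the Cayley element\<close>

lemma cayley_summand:
  assumes D: "chebT_derivation n D" and k: "1 \<le> k" "k \<le> n"
  shows "X 0 ^ (n - 1) * (emb ((D ^^ k) (Var n)) * (- X 1 / X 0) ^ k / of_nat (fact k)) =
    scal ((-2) ^ k * of_nat n / fact k) *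
      ((\<Sum>i\<le>(n - k) div 2.
          scal (cheb_coeff n k i) * X (n - k - 2 * i) * X 1 ^ k * X 0 powi (int n - 1 - int k)) -
       scal ((1 + (-1) ^ (n - k)) / 4 *
             falling_fact (of_nat (n + k) / 2 - 1) (k - 1) *
             ((of_nat (n + k) / 2 - 1) gchoose (k - 1))) *
       X 1 ^ k * X 0 ^ (n - k))"
proof -
  define S where "S = (\<Sum>i\<le>(n - k) div 2. scal (cheb_coeff n k i) * X (n - k - 2 * i))"
  define t where "t = (1 + (-1) ^ (n - k)) / 4 *
             falling_fact (of_nat (n + k) / 2 - 1) (k - 1) *
             ((of_nat (n + k) / 2 - 1) gchoose (k - 1))"
  define p where "p = X 0 powi (int n - 1 - int k)"
  let ?h = "(n - k) div 2"
  \<comment> \<open>Going back from \<open>halfvar\<close> to \<open>X\<close> costs half an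
    \<open>X 0\<close> at index 0; this is the origin of the subtracted term of the theorem.\<close>
  have halfvar: "emb (halfvar j) = X j - (if j = 0 then scal (1/2) * X 0 else 0)" for j
  proof -
    have "scal (1/2) + scal (1/2) = 1"
      by (simp add: scal_simps(2) flip: scal_simps(3))
    then have "X 0 - scal (1/2) * X 0 = scal (1/2) * X 0"
      by (metis add_diff_cancel_left' distrib_right mult_1)
    then show ?thesis
      by (simp add: halfvar_def emb_simps X_def scal_def)
  qed
  \<comment> \<open>Index 0 occurs only for even \<open>n - k\<close>, at \<open>i = ?h\<close>; so
    \<open>(1 + (-1)^(n - k)) / 4\<close> is 1/2 times the indicator of that case.\<close>
  have corr: "(\<Sum>i\<le>?h. scal (cheb_coeff n k i) * (if n - k - 2 * i = 0 then scal (1/2) * X 0 else 0)) =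
      scal t * X 0"
  proof (cases "even (n - k)")
    case True
    then have n: "n = k + 2 * ?h"
      using k by auto
    then have n': "(of_nat n :: complex) = of_nat k + 2 * of_nat ?h"
      by (metis of_nat_add of_nat_mult of_nat_numeral)
    \<comment> \<open>At \<open>i = ?h\<close> the arguments of the falling factorial and of the
      binomial coincide.\<close>
    have m: "of_nat (n + k) / 2 - 1 = (of_nat n - of_nat ?h - 1 :: complex)"
      "of_nat (n + k) / 2 - 1 = (of_nat k + of_nat ?h - 1 :: complex)"
      unfolding of_nat_add n' by simp_all
    have t: "t = cheb_coeff n k ?h / 2"
      unfolding t_def cheb_coeff_def m[symmetric] using True by simp
    have "n - k - 2 * i = 0 \<longleftrightarrow> i = ?h" if "i \<le> ?h" for i
      using that n by linarith
    then have "(\<Sum>i\<le>?h. scal (cheb_coeff n k i) * (if n - k - 2 * i = 0 then scal (1/2) * X 0 else 0)) =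
        (\<Sum>i\<le>?h. if i = ?h then scal (cheb_coeff n k i) * (scal (1/2) * X 0) else 0)"
      by (intro sum.cong) auto
    moreover have "scal t = scal (cheb_coeff n k ?h) * scal (1/2)"
      unfolding t by (simp flip: scal_simps(4))
    ultimately show ?thesis
      by simp
  next
    case False
    have "n - k - 2 * i \<noteq> 0" if "i \<le> ?h" for i
    proof
      assume "n - k - 2 * i = 0"
      with that have "n - k = 2 * i"
        by linarith
      with False show False
        by simp
    qed
    moreover have "t = 0"
      using False by (simp add: t_def)
    ultimately show ?thesis
      by (simp add: scal_simps)
  qed
  have "emb ((D ^^ k) (Var n)) =
      scal (2 ^ k * of_nat n) * (\<Sum>i\<le>?h. scal (cheb_coeff n k i) * emb (halfvar (n - k - 2 * i)))"
    unfolding chebT_derivation_funpow[OF D k] by (simp add: emb_simps emb_sum scal_def)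
  also have "\<dots> = scal (2 ^ k * of_nat n) * (S - scal t * X 0)"
    unfolding halfvar right_diff_distrib[of "scal _"] sum_subtractf corr S_def ..
  finally have E: "emb ((D ^^ k) (Var n)) = scal (2 ^ k * of_nat n) * (S - scal t * X 0)" .
  have "X 0 ^ (n - 1) = X 0 powi int (n - 1)"
    by simp
  \<comment> \<open>The exponent is split over the integers because \<open>n - 1 - k\<close> is -1
    at \<open>k = n\<close>.\<close>
  also have "int (n - 1) = int n - 1 - int k + int k"
    using k by simp
  also have "X 0 powi \<dots> = p * X 0 ^ k"
    unfolding p_def by (subst power_int_add) (simp_all add: X_neq_0)
  finally have "X 0 ^ (n - 1) * (- X 1 / X 0) ^ k = (- X 1) ^ k * p"
    unfolding power_divide by (simp add: X_neq_0)
  also have "(- X 1) ^ k = scal ((-1) ^ k) * X 1 ^ k"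
    by (subst power_minus) (simp add: scal_power scal_simps(2,5))
  finally have P: "X 0 ^ (n - 1) * (- X 1 / X 0) ^ k = scal ((-1) ^ k) * X 1 ^ k * p" .
  have "X 0 ^ (n - k) = X 0 powi (1 + (int n - 1 - int k))"
    using k by (simp flip: power_int_of_nat add: of_nat_diff)
  then have Q: "X 0 ^ (n - k) = X 0 * p"
    unfolding p_def by (subst (asm) power_int_add) (simp_all add: X_neq_0)
  have C: "scal ((-2) ^ k * of_nat n / fact k) = scal ((-1) ^ k) * scal (2 ^ k * of_nat n) / of_nat (fact k)"
    by (simp add: power_minus[of 2] scal_divide scal_simps(4) scal_power flip: scal_of_nat)
  have "X 0 ^ (n - 1) * (emb ((D ^^ k) (Var n)) * (- X 1 / X 0) ^ k / of_nat (fact k)) =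
      emb ((D ^^ k) (Var n)) * (X 0 ^ (n - 1) * (- X 1 / X 0) ^ k) / of_nat (fact k)"
    by simp
  also have "\<dots> = scal ((-2) ^ k * of_nat n / fact k) * (S * X 1 ^ k * p - scal t * X 1 ^ k * X 0 ^ (n - k))"
    unfolding E P Q C
    by (simp only: diff_divide_distrib times_divide_eq_left times_divide_eq_right
        right_diff_distrib left_diff_distrib mult_ac)
  finally show ?thesis
    unfolding S_def t_def p_def sum_distrib_right .
qed

section \<open>The Cayley element as a polynomial\<close>

lemma cayley_eq_sum:
  assumes "chebT_derivation n D"
  shows "cayley n D =
    (\<Sum>k\<le>n. X 0 ^ (n - 1) * (emb ((D ^^ k) (Var n)) * (- X 1 / X 0) ^ k / of_nat (fact k)))"
proof -
  have "(D ^^ k) (Var n) = 0" if "k > n" for k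
    using chebT_derivation_nilpotent[OF assms le_refl that] .
  then have "{k. emb ((D ^^ k) (Var n)) * (- X 1 / X 0) ^ k / of_nat (fact k) \<noteq> 0} \<subseteq> {..n}"
    by (auto simp: emb_simps intro: leI)
  then show ?thesis
    unfolding cayley_def sigma_def by (subst Sum_any.expand_superset) (auto simp: sum_distrib_left)
qed

text \<open>Carries facts about the polynomial sum over to the Cayley element. The extra
  \<open>X 0\<close> arises because the former is scaled by \<open>x_0^n\<close>, the latter by
  \<open>x_0^(n-1)\<close>.\<close>

lemma emb_dixmier_sum:
  assumes n: "n \<ge> 1" and D: "chebT_derivation n D"
  shows "emb (dixmier_sum n D (Var n)) = X 0 * cayley n D"
proof -
  have "emb (Const (1 / fact k) * ((D ^^ k) (Var n) * (- Var 1) ^ k * Var 0 ^ (n - k))) =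
      X 0 * (X 0 ^ (n - 1) * (emb ((D ^^ k) (Var n)) * (- X 1 / X 0) ^ k / of_nat (fact k)))"
    if "k \<le> n" for k
  proof -
    have "X 0 * X 0 ^ (n - 1) = X 0 ^ (n - k) * X 0 ^ k"
      using n that by (simp flip: power_Suc power_add)
    then have "X 0 * (X 0 ^ (n - 1) * (emb ((D ^^ k) (Var n)) * (- X 1 / X 0) ^ k / of_nat (fact k))) =
        X 0 ^ (n - k) * X 0 ^ k * (emb ((D ^^ k) (Var n)) * (- X 1 / X 0) ^ k / of_nat (fact k))"
      by (simp add: mult.assoc)
    also have "\<dots> = (1 / of_nat (fact k)) * (emb ((D ^^ k) (Var n)) * (- X 1) ^ k * X 0 ^ (n - k))"
      unfolding power_divide by (simp add: X_neq_0)
    also have "1 / of_nat (fact k) = emb (Const (1 / fact k))"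
      by (simp add: scal_divide scal_simps flip: scal_def scal_of_nat)
    finally show ?thesis
      by (simp add: emb_simps emb_power X_def)
  qed
  then show ?thesis
    unfolding dixmier_sum_def cayley_eq_sum[OF D] by (simp add: emb_sum sum_distrib_left)
qed

text \<open>Each summand with \<open>k < n\<close> has the factor \<open>Var 0 ^ (n - k)\<close>; at
  \<open>k = n\<close> the factor \<open>Var 0\<close> comes from \<open>(D ^^ n) (Var n)\<close>
  instead.\<close>

lemma dixmier_sum_dvd:
  assumes n: "n \<ge> 1" and D: "chebT_derivation n D"
  shows "\<exists>f \<in> polys n. dixmier_sum n D (Var n) = Var 0 * f"
proof -
  have der: "derivation_on n D"
    using D by (simp add: chebT_derivation_def)
  \<comment> \<open>The formula for the iterates at \<open>k = n\<close>, where only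
    \<open>halfvar 0\<close> remains and contributes 1/2.\<close>
  define c where "c = 2 ^ n * of_nat n * cheb_coeff n n 0 * (1/2)"
  have c: "(D ^^ n) (Var n) = Var 0 * Const c"
    using chebT_derivation_funpow[OF D n le_refl] unfolding c_def Const_simps
    by (simp add: halfvar_def mult_ac)
  define f where "f = (\<Sum>k<n. Const (1 / fact k) * ((D ^^ k) (Var n) * (- Var 1) ^ k * Var 0 ^ (n - 1 - k)))
     + Const (1 / fact n) * (Const c * (- Var 1) ^ n)"
  have "Const (1 / fact k) * ((D ^^ k) (Var n) * (- Var 1) ^ k * Var 0 ^ (n - k)) =
      Var 0 * (Const (1 / fact k) * ((D ^^ k) (Var n) * (- Var 1) ^ k * Var 0 ^ (n - 1 - k)))"
    if "k < n" for k
  proof -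
    have "n - k = Suc (n - 1 - k)"
      using that by simp
    then show ?thesis
      by (simp add: mult_ac)
  qed
  then have "(\<Sum>k<n. Const (1 / fact k) * ((D ^^ k) (Var n) * (- Var 1) ^ k * Var 0 ^ (n - k))) =
      Var 0 * (\<Sum>k<n. Const (1 / fact k) * ((D ^^ k) (Var n) * (- Var 1) ^ k * Var 0 ^ (n - 1 - k)))"
    unfolding sum_distrib_left by (intro sum.cong) auto
  moreover have "Const (1 / fact n) * ((D ^^ n) (Var n) * (- Var 1) ^ n * Var 0 ^ (n - n)) =
      Var 0 * (Const (1 / fact n) * (Const c * (- Var 1) ^ n))"
    unfolding c by (simp add: mult_ac)
  ultimately have "dixmier_sum n D (Var n) = Var 0 * f"
    unfolding dixmier_sum_def f_def lessThan_Suc_atMost[symmetric] sum.lessThan_Suc distrib_left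
    by (simp only:)
  moreover have "f \<in> polys n"
    unfolding f_def using n
    by (intro polys_add polys_sum polys_mult polys_power polys_minus polys_Const polys_Var
        derivation_on_funpow(1)[OF der]) auto
  ultimately show ?thesis
    by blast
qed

theorem theorem1:
  fixes n :: nat and D :: "cpoly \<Rightarrow> cpoly"
  assumes "n \<ge> 1" and "chebT_derivation n D"
  shows "cayley n D \<in> emb ` ker_deriv n D \<and>
    cayley n D =
      X n * X 0 ^ (n - 1) +
      (\<Sum>k = 1..n. scal ((-2) ^ k * of_nat n / fact k) *
        ((\<Sum>i = 0..(n - k) div 2.
            scal (falling_fact (of_nat n - of_nat i - 1) (k - 1) *
                  ((of_nat k + of_nat i - 1) gchoose (k - 1))) *
            X (n - k - 2 * i) * X 1 ^ k * X 0 powi (int n - 1 - int k)) -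
         scal ((1 + (-1) ^ (n - k)) / 4 *
               falling_fact (of_nat (n + k) / 2 - 1) (k - 1) *
               ((of_nat (n + k) / 2 - 1) gchoose (k - 1))) *
         X 1 ^ k * X 0 ^ (n - k)))"
proof
  have D: "derivation_on n D" "D (Var 0) = 0" "D (Var 1) = Var 0"
    using assms by (auto simp: chebT_derivation_def chebT_image_def Const_simps)
  obtain f where f: "f \<in> polys n" "dixmier_sum n D (Var n) = Var 0 * f"
    using dixmier_sum_dvd[OF assms] by blast
  \<comment> \<open>As \<open>D (Var 0) = 0\<close>, the factor \<open>Var 0\<close> passes through
    \<open>D\<close> and can then be cancelled.\<close>
  have "Var 0 * D f = D (Var 0 * f)"
    using f D by (simp add: derivation_on_mult polys_Var)
  also have "\<dots> = 0"
    using derivation_on_dixmier_sum[OF D assms(1) polys_Var[of n n]]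
      chebT_derivation_nilpotent[OF assms(2), of n "Suc n"] f by simp
  finally have "f \<in> ker_deriv n D"
    using f by (simp add: ker_deriv_def Var_neq_0)
  moreover have "cayley n D = emb f"
    using emb_dixmier_sum[OF assms] f by (simp add: emb_simps X_neq_0 flip: X_def)
  ultimately show "cayley n D \<in> emb ` ker_deriv n D"
    by blast
next
  \<comment> \<open>The formula for the iterates starts at \<open>k = 1\<close>; the term at
    \<open>k = 0\<close> is the leading \<open>X n * X 0 ^ (n - 1)\<close>.\<close>
  have "{..n} = insert 0 {1..n}"
    by auto
  then have E: "cayley n D = X n * X 0 ^ (n - 1) +
      (\<Sum>k = 1..n. X 0 ^ (n - 1) * (emb ((D ^^ k) (Var n)) * (- X 1 / X 0) ^ k / of_nat (fact k)))"
    unfolding cayley_eq_sum[OF assms(2)] by (simp add: X_def mult.commute)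
  show "cayley n D =
      X n * X 0 ^ (n - 1) +
      (\<Sum>k = 1..n. scal ((-2) ^ k * of_nat n / fact k) *
        ((\<Sum>i = 0..(n - k) div 2.
            scal (falling_fact (of_nat n - of_nat i - 1) (k - 1) *
                  ((of_nat k + of_nat i - 1) gchoose (k - 1))) *
            X (n - k - 2 * i) * X 1 ^ k * X 0 powi (int n - 1 - int k)) -
         scal ((1 + (-1) ^ (n - k)) / 4 *
               falling_fact (of_nat (n + k) / 2 - 1) (k - 1) *
               ((of_nat (n + k) / 2 - 1) gchoose (k - 1))) *
         X 1 ^ k * X 0 ^ (n - k)))"
    unfolding E atLeast0AtMost cheb_coeff_def[symmetric]
    by (intro arg_cong2[where f = "(+)"] sum.cong refl cayley_summand[OF assms(2)]) auto
qed

end
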